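(* Let $X$ be a uniformly smooth Banach space and let $S=(X;X_k,k\geqslant 1)$ be a system of closed linear subspaces of $X$. Then the following statements are equivalent: (1) $S$ is an absolutely representing system of subspaces in $X$; (2) there exist $\tau,\lambda\in(0,1)$ such that $\tau D(S)$ is a $\lambda$-net for $V_X$; (3) $\lambda_S:=\sup_{\|x\|=1}\inf_{k\geqslant 1}d(x,X_k)<1$.
   Context: $X$ is a Banach space over $\mathbb{K}$ ($=\mathbb{R}$ or $\mathbb{C}$). The modulus of smoothness of $X$ is $\rho(\tau)=\sup\{(\|x+y\|+\|x-y\|)/2-1: \|x\|=1,\ \|y\|=\tau\}$, $\tau>0$; $X$ is uniformly smooth if $\rho(\tau)/\tau\to0$ as $\tau\to0$. A system $S=(X;X_k,k\geqslant 1)$ of closed linear subspaces of $X$ is an absolutely representing system of subspaces in $X$ if every $x\in X$ can be written as $x=\sum_{k=1}^\infty x_k$ with $x_k\in X_k$ and $\sum_{k=1}^\infty\|x_k\|<\infty$. For a normed space $Z$, $V_Z=\{x\in Z:\|x\|=1\}$; $D(S)=\bigcup_{k=1}^\infty V_{X_k}$ and $\tau D(S)=\{\tau x:x\in D(S)\}$. A set $A$ is a $\lambda$-net for a set $B$ if for every $x\in B$ there exists $y\in A$ with $\|x-y\|\leqslant\lambda$. $d(x,X_k)$ is the distance from $x$ to $X_k$. *)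

theory Defs
  imports "HOL-Analysis.Analysis"
begin

(* A normed space over K = R or C whose underlying real normed space is the type 'a.
   By the theorem of Gelfand-Mazur, a type 'k of class real_normed_field is R or C up to
   isometric isomorphism, so quantifying over 'k amounts to exactly these two cases. *)
locale normed_space_over = vector_space sc
  for sc :: "'k::real_normed_field \<Rightarrow> 'a::real_normed_vector \<Rightarrow> 'a" +
  assumes sc_of_real: "sc (of_real r) x = r *\<^sub>R x"
    and norm_sc: "norm (sc c x) = norm c * norm x"

definition unit_sphere_of :: "'a::real_normed_vector set \<Rightarrow> 'a set" where
  "unit_sphere_of Z = {x \<in> Z. norm x = 1}"

(* Here and in covering_defect the suprema are taken in [0, \<infinity>], which gives the value 0 on
   the zero space, where the sets are empty. The argument of ennreal is nonnegative
   because 2 = norm ((x + y) + (x - y)) \<le> norm (x + y) + norm (x - y). *)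
definition modulus_of_smoothness :: "'a::real_normed_vector itself \<Rightarrow> real \<Rightarrow> ennreal" where
  "modulus_of_smoothness _ \<tau> =
     Sup {ennreal ((norm (x + y) + norm (x - y)) / 2 - 1) | x y :: 'a. norm x = 1 \<and> norm y = \<tau>}"

definition uniformly_smooth :: "'a::real_normed_vector itself \<Rightarrow> bool" where
  "uniformly_smooth T \<longleftrightarrow>
     ((\<lambda>\<tau>. modulus_of_smoothness T \<tau> / ennreal \<tau>) \<longlongrightarrow> 0) (at_right 0)"

(* The sequence X_1, X_2, ... is indexed from 0. *)
definition subspace_system ::
    "('k::real_normed_field \<Rightarrow> 'a::real_normed_vector \<Rightarrow> 'a) \<Rightarrow> (nat \<Rightarrow> 'a set) \<Rightarrow> bool" where
  "subspace_system sc S \<longleftrightarrow> (\<forall>k. module.subspace sc (S k) \<and> closed (S k))"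

definition absolutely_representing :: "(nat \<Rightarrow> 'a::real_normed_vector set) \<Rightarrow> bool" where
  "absolutely_representing S \<longleftrightarrow>
     (\<forall>x. \<exists>u. (\<forall>k. u k \<in> S k) \<and> summable (\<lambda>k. norm (u k)) \<and> u sums x)"

definition sphere_union :: "(nat \<Rightarrow> 'a::real_normed_vector set) \<Rightarrow> 'a set" where
  "sphere_union S = (\<Union>k. unit_sphere_of (S k))"

definition is_net :: "real \<Rightarrow> 'a::real_normed_vector set \<Rightarrow> 'a set \<Rightarrow> bool" where
  "is_net \<mu> A B \<longleftrightarrow> (\<forall>x\<in>B. \<exists>y\<in>A. norm (x - y) \<le> \<mu>)"

definition covering_defect :: "(nat \<Rightarrow> 'a::real_normed_vector set) \<Rightarrow> ennreal" where
  "covering_defect S = (SUP x\<in>unit_sphere_of UNIV. INF k. ennreal (infdist x (S k)))"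

end

theory Submission
  imports Defs
begin

text \<open>
  The implication from the net condition to \<open>covering_defect S < 1\<close> is immediate. If the defect
  is below \<open>\<mu> < 1\<close>, then every \<open>x\<close> is within \<open>\<mu> \<cdot> norm x\<close> of some \<open>y\<close> in some \<open>S k\<close>;
  iterating this on the remainders yields a series with geometrically decreasing terms, each in
  some \<open>S k\<close>, and collecting the terms by the subspace they belong to gives an absolutely
  representing series (lemma \<open>absolutely_representing_of_approximation\<close>).

  The remaining implication uses uniform smoothness. Let \<open>S\<close> be absolutely representing. Baire's
  theorem provides a constant \<open>C\<close> such that every vector \<open>x\<close> is, up to an error of norm at most
  \<open>norm x / 2\<close>, a sum \<open>w\<close> of vectors \<open>u k \<in> S k\<close> with total norm \<open>A \<le> C \<cdot> norm x\<close>
  (lemma \<open>representing_imp_controlled_approximation\<close>). Let \<open>x\<close> be a unit vector. Writing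
  \<open>A x + \<tau> w\<close> as the sum of the vectors \<open>norm (u k) x + \<tau> u k\<close>, the triangle inequality shows
  that \<open>norm (x + \<tau> y) \<ge> 1 + \<tau> c\<close> for one of the normalised vectors \<open>y = u k / norm (u k)\<close>,
  where \<open>c\<close> depends only on \<open>C\<close> (lemma \<open>exists_direction_of_increase\<close>). This averaging takes the
  place of testing the \<open>u k\<close> against a norming functional of \<open>x\<close>. Uniform smoothness bounds
  \<open>norm (x + \<tau> y) + norm (x - \<tau> y)\<close> by \<open>2 + \<tau> c / 2\<close> when \<open>\<tau>\<close> is small, independently of \<open>x\<close>
  and \<open>y\<close>, so that \<open>norm (x - \<tau> y) \<le> 1 - \<tau> c / 2\<close>.
\<close>

section \<open>Absolutely convergent series grouped by subspaces\<close>

lemma regroup_norm_summable: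
  fixes f :: "nat \<Rightarrow> 'a::banach" and \<kappa> :: "nat \<Rightarrow> nat"
  assumes f: "summable (\<lambda>n. norm (f n))"
  defines "u \<equiv> \<lambda>k. infsum f {n. \<kappa> n = k}"
  shows "summable (\<lambda>k. norm (u k))" and "u sums suminf f"
proof -
  define B where "B = (\<lambda>k. {n. \<kappa> n = k})"
  have bij: "bij_betw snd (Sigma UNIV B) UNIV"
    by (rule bij_betwI[where g="\<lambda>n. (\<kappa> n, n)"]) (auto simp: B_def)
  have abs: "(\<lambda>n. norm (f n)) summable_on UNIV"
    using norm_summable_imp_summable_on[of "\<lambda>n. norm (f n)"] f by simp
  have "(\<lambda>p. norm (f (snd p))) summable_on Sigma UNIV B"
    using abs summable_on_reindex_bij_betw[OF bij, of "\<lambda>n. norm (f n)"] by simp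
  then have fib: "(\<lambda>n. norm (f n)) summable_on B k"
    and out: "(\<lambda>k. norm (infsum (\<lambda>n. norm (f n)) (B k))) summable_on UNIV"
    and tot: "(\<lambda>p. f (snd p)) summable_on Sigma UNIV B" for k
    using Infinite_Sum.abs_summable_on_Sigma_iff[of "\<lambda>p. f (snd p)" UNIV B] abs_summable_summable by auto
  have bound: "norm (u k) \<le> infsum (\<lambda>n. norm (f n)) (B k)" for k
    unfolding u_def using norm_infsum_bound[OF fib[of k]] by (simp add: B_def)
  have nn: "0 \<le> infsum (\<lambda>n. norm (f n)) (B k)" for k
    by (rule infsum_nonneg) simp
  have "summable (\<lambda>k. infsum (\<lambda>n. norm (f n)) (B k))"
    using out nn by (simp add: summable_on_imp_summable)
  then show sum_u: "summable (\<lambda>k. norm (u k))"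
    by (rule summable_comparison_test') (use bound in auto)
  have "infsum u UNIV = infsum (\<lambda>p. f (snd p)) (Sigma UNIV B)"
    using infsum_Sigma_banach[OF tot] by (simp add: u_def B_def)
  also have "\<dots> = infsum f UNIV"
    by (rule infsum_reindex_bij_betw[OF bij])
  also have "\<dots> = suminf f"
    using norm_summable_imp_has_sum[OF f summable_sums[OF summable_norm_cancel[OF f]]]
    by (simp add: infsumI)
  finally have "infsum u UNIV = suminf f" .
  moreover have "infsum u UNIV = suminf u"
    using norm_summable_imp_has_sum[OF sum_u summable_sums[OF summable_norm_cancel[OF sum_u]]]
    by (simp add: infsumI)
  ultimately show "u sums suminf f"
    using summable_norm_cancel[OF sum_u] by (simp add: sums_iff)
qed

lemma infsum_in_closed_subspace:
  fixes f :: "'b \<Rightarrow> 'a::real_normed_vector"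
  assumes "subspace V" "closed V" and f: "\<And>n. n \<in> A \<Longrightarrow> f n \<in> V"
  shows "infsum f A \<in> V"
proof (cases "f summable_on A")
  case True
  then have "(sum f \<longlongrightarrow> infsum f A) (finite_subsets_at_top A)"
    using has_sum_infsum by (simp add: has_sum_def)
  moreover have "eventually (\<lambda>F. sum f F \<in> V) (finite_subsets_at_top A)"
    by (rule eventually_finite_subsets_at_top_weakI)
      (use f in \<open>auto intro!: subspace_sum[OF \<open>subspace V\<close>]\<close>)
  ultimately show ?thesis
    by (intro Lim_in_closed_set[OF \<open>closed V\<close>]) auto
next
  case False
  then show ?thesis
    by (simp add: infsum_not_exists subspace_0[OF \<open>subspace V\<close>])
qed

section \<open>From approximation to representation\<close>

lemma absolutely_representing_of_approximation:
  fixes S :: "nat \<Rightarrow> 'a::banach set"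
  assumes sub: "\<And>k. subspace (S k)" and cl: "\<And>k. closed (S k)"
    and \<mu>: "0 \<le> \<mu>" "\<mu> < 1"
    and approx: "\<And>x. norm x = 1 \<Longrightarrow> \<exists>k. \<exists>y\<in>S k. norm (x - y) \<le> \<mu>"
  shows "absolutely_representing S"
  unfolding absolutely_representing_def
proof
  fix x :: 'a
  have "\<exists>k y. y \<in> S k \<and> norm (z - y) \<le> \<mu> * norm z" for z
  proof (cases "z = 0")
    case True
    then show ?thesis using subspace_0[OF sub] by force
  next
    case False
    then obtain k y where y: "y \<in> S k" "norm (z /\<^sub>R norm z - y) \<le> \<mu>"
      using approx[of "z /\<^sub>R norm z"] by auto
    have "z - norm z *\<^sub>R y = norm z *\<^sub>R (z /\<^sub>R norm z - y)"
      using False by (simp add: algebra_simps)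
    then have "norm (z - norm z *\<^sub>R y) \<le> \<mu> * norm z"
      using mult_left_mono[OF y(2) norm_ge_zero[of z]] by (simp add: mult.commute)
    then show ?thesis using y(1) subspace_scale[OF sub] by blast
  qed
  then obtain \<kappa> g where g: "\<And>z. g z \<in> S (\<kappa> z)" "\<And>z. norm (z - g z) \<le> \<mu> * norm z"
    by metis
  \<comment> \<open>The remainder \<open>r n\<close> left after \<open>n\<close> approximation steps.\<close>
  define r where "r = rec_nat x (\<lambda>_ z. z - g z)"
  have r0: "r 0 = x" and rS: "r (Suc n) = r n - g (r n)" for n
    by (simp_all add: r_def)
  have r: "norm (r n) \<le> \<mu> ^ n * norm x" for n
  proof (induction n)
    case (Suc n)
    have "norm (r (Suc n)) \<le> \<mu> * norm (r n)"
      using g(2) by (simp add: rS)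
    also have "\<dots> \<le> \<mu> * (\<mu> ^ n * norm x)"
      using Suc \<mu> by (intro mult_left_mono) auto
    finally show ?case by simp
  qed (simp add: r0)
  define f where "f = (\<lambda>n. g (r n))"
  have geom: "summable (\<lambda>n. 2 * norm x * \<mu> ^ n)"
    using \<mu> by (intro summable_mult summable_geometric) simp
  have "norm (f n) \<le> 2 * norm x * \<mu> ^ n" for n
  proof -
    have "f n = r n - (r n - g (r n))" by (simp add: f_def)
    then have "norm (f n) \<le> norm (r n) + norm (r n - g (r n))"
      by (metis norm_triangle_ineq4)
    also have "\<dots> \<le> norm (r n) + \<mu> * norm (r n)"
      using g(2) by simp
    also have "\<dots> \<le> 2 * norm (r n)"
      using \<mu> mult_right_mono[of \<mu> 1 "norm (r n)"] by simp
    also have "\<dots> \<le> 2 * norm x * \<mu> ^ n"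
      using r[of n] by (simp add: mult.commute)
    finally show ?thesis .
  qed
  then have sum_f: "summable (\<lambda>n. norm (f n))"
    by (intro summable_comparison_test'[OF geom]) auto
  have partial: "(\<Sum>i<n. f i) = x - r n" for n
    by (induction n) (simp_all add: r0 rS f_def)
  have "r \<longlonglongrightarrow> 0"
  proof (rule Lim_null_comparison)
    show "(\<lambda>n. \<mu> ^ n * norm x) \<longlonglongrightarrow> 0"
      using \<mu> by (intro tendsto_mult_left_zero LIMSEQ_power_zero) simp
  qed (use r in auto)
  then have "(\<lambda>n. x - r n) \<longlonglongrightarrow> x - 0"
    by (intro tendsto_intros)
  then have "f sums x"
    by (simp add: sums_def partial)
  then have x: "suminf f = x"
    by (simp add: sums_iff)
  define u where "u = (\<lambda>k. infsum f {n. \<kappa> (r n) = k})"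
  have "u k \<in> S k" for k
    unfolding u_def
    by (rule infsum_in_closed_subspace[OF sub cl]) (use g(1) in \<open>auto simp: f_def\<close>)
  moreover have "summable (\<lambda>k. norm (u k))" "u sums x"
    using regroup_norm_summable[OF sum_f, of "\<lambda>n. \<kappa> (r n)"] by (simp_all add: u_def x)
  ultimately show "\<exists>u. (\<forall>k. u k \<in> S k) \<and> summable (\<lambda>k. norm (u k)) \<and> u sums x"
    by blast
qed

section \<open>Representations with controlled total norm\<close>

text \<open>The vectors that are represented by a series with terms in the \<open>S k\<close> of total norm at most
  \<open>C\<close>.\<close>

definition representable_within :: "(nat \<Rightarrow> 'a::real_normed_vector set) \<Rightarrow> real \<Rightarrow> 'a set" where
  "representable_within S C =
     {w. \<exists>u. (\<forall>k. u k \<in> S k) \<and> summable (\<lambda>k. norm (u k)) \<and> u sums w \<and> (\<Sum>k. norm (u k)) \<le> C}"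

lemma representable_within_diff:
  assumes sub: "\<And>k. subspace (S k)"
    and "v \<in> representable_within S C" "w \<in> representable_within S D"
  shows "v - w \<in> representable_within S (C + D)"
proof -
  obtain a b where a: "\<forall>k. a k \<in> S k" "summable (\<lambda>k. norm (a k))" "a sums v" "(\<Sum>k. norm (a k)) \<le> C"
    and b: "\<forall>k. b k \<in> S k" "summable (\<lambda>k. norm (b k))" "b sums w" "(\<Sum>k. norm (b k)) \<le> D"
    using assms(2,3) unfolding representable_within_def by blast
  have s: "summable (\<lambda>k. norm (a k) + norm (b k))"
    using a b by (intro summable_add)
  have t: "summable (\<lambda>k. norm (a k - b k))"
    by (rule summable_comparison_test'[OF s]) (simp add: norm_triangle_ineq4)
  have "(\<Sum>k. norm (a k - b k)) \<le> (\<Sum>k. norm (a k) + norm (b k))"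
    using s t by (intro suminf_le) (auto simp: norm_triangle_ineq4)
  also have "\<dots> \<le> C + D"
    using a b by (simp add: suminf_add[symmetric])
  finally have "(\<Sum>k. norm (a k - b k)) \<le> C + D" .
  moreover have "\<forall>k. a k - b k \<in> S k"
    using a(1) b(1) subspace_diff[OF sub] by blast
  ultimately show ?thesis
    unfolding representable_within_def using t sums_diff[OF a(3) b(3)]
    by (intro CollectI exI[of _ "\<lambda>k. a k - b k"] conjI)
qed

lemma representable_within_scaleR:
  assumes sub: "\<And>k. subspace (S k)" and "w \<in> representable_within S C"
  shows "t *\<^sub>R w \<in> representable_within S (\<bar>t\<bar> * C)"
proof -
  obtain a where a: "\<forall>k. a k \<in> S k" "summable (\<lambda>k. norm (a k))" "a sums w" "(\<Sum>k. norm (a k)) \<le> C"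
    using assms(2) unfolding representable_within_def by blast
  have "(\<Sum>k. norm (t *\<^sub>R a k)) = \<bar>t\<bar> * (\<Sum>k. norm (a k))"
    using a by (simp add: suminf_mult)
  also have "\<dots> \<le> \<bar>t\<bar> * C"
    using a by (intro mult_left_mono) auto
  finally have "(\<Sum>k. norm (t *\<^sub>R a k)) \<le> \<bar>t\<bar> * C" .
  moreover have "\<forall>k. t *\<^sub>R a k \<in> S k"
    using a(1) subspace_scale[OF sub] by blast
  moreover have "summable (\<lambda>k. norm (t *\<^sub>R a k))"
    using summable_mult[OF a(2)] by simp
  ultimately show ?thesis
    unfolding representable_within_def using sums_scaleR_right[OF a(3), of t]
    by (intro CollectI exI[of _ "\<lambda>k. t *\<^sub>R a k"] conjI)
qed

text \<open>The closures of the sets \<open>representable_within S n\<close> exhaust the space, so one of them has an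
  interior point \<open>z\<close>; differences of approximants of \<open>z + v\<close> and \<open>z\<close> approximate all vectors \<open>v\<close>
  of a fixed small norm, and the general case follows by scaling. This is the first half of the
  proof of the open mapping theorem.\<close>

lemma representing_imp_controlled_approximation:
  fixes S :: "nat \<Rightarrow> 'a::banach set"
  assumes sub: "\<And>k. subspace (S k)" and rep: "absolutely_representing S"
  obtains C where "0 < C"
    and "\<And>x. \<exists>w\<in>representable_within S (C * norm x). norm (x - w) \<le> norm x / 2"
proof -
  define F where "F = (\<lambda>n::nat. closure (representable_within S (real n)))"
  have "x \<in> (\<Union>n. F n)" for x
  proof -
    obtain u where u: "\<forall>k. u k \<in> S k" "summable (\<lambda>k. norm (u k))" "u sums x"
      using rep unfolding absolutely_representing_def by blast
    obtain n :: nat where "(\<Sum>k. norm (u k)) \<le> real n"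
      using real_arch_simple by blast
    then have "x \<in> representable_within S (real n)"
      unfolding representable_within_def using u by blast
    then show ?thesis
      unfolding F_def using closure_subset by blast
  qed
  then have cover: "\<Union>(range F) = UNIV" by auto
  have "\<exists>n. interior (F n) \<noteq> {}"
  proof (rule ccontr)
    assume "\<not> ?thesis"
    then have empty: "interior (F n) = {}" for n by blast
    have "Met_TC.mtopology interior_of \<Union>(range F) = {}"
    proof (rule Met_TC.metric_Baire_category_alt)
      show "Met_TC.mcomplete (TYPE('a))"
        by (simp add: mcomplete_iff_complete complete_UNIV)
      fix T assume "T \<in> range F"
      then show "closedin Met_TC.mtopology T \<and> Met_TC.mtopology interior_of T = {}"
        using empty by (auto simp: F_def)
    qed simp
    then show False by (simp only: cover mtopology_is_euclidean) simp
  qed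
  then obtain n z where "z \<in> interior (F n)" by blast
  then obtain e where e: "0 < e" "ball z e \<subseteq> F n"
    using mem_interior by blast
  define s where "s = e / 2"
  have s: "0 < s" "s < e" using e by (auto simp: s_def)
  define C where "C = (2 * real n + 1) / s"
  have "\<exists>w\<in>representable_within S (C * norm x). norm (x - w) \<le> norm x / 2" for x
  proof (cases "x = 0")
    case True
    have "0 \<in> representable_within S 0"
      unfolding representable_within_def using subspace_0[OF sub]
      by (intro CollectI exI[of _ "\<lambda>_. 0"]) auto
    then show ?thesis using True by auto
  next
    case False
    define v where "v = (s / norm x) *\<^sub>R x"
    have nv: "norm v = s" using False s by (simp add: v_def)
    have "z + v \<in> F n" "z \<in> F n"
      using e(1) s(2) nv by (simp_all add: subsetD[OF e(2)] dist_norm)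
    moreover have "0 < s / 4" using s by simp
    ultimately obtain p q where p: "p \<in> representable_within S (real n)" "dist p (z + v) < s / 4"
      and q: "q \<in> representable_within S (real n)" "dist q z < s / 4"
      unfolding F_def closure_approachable by meson
    have "v - (p - q) = (q - z) - (p - (z + v))" by simp
    then have "norm (v - (p - q)) \<le> norm (q - z) + norm (p - (z + v))"
      by (metis norm_triangle_ineq4)
    also have "\<dots> \<le> s / 2"
      using p(2) q(2) by (simp add: dist_norm)
    finally have near: "norm (v - (p - q)) \<le> s / 2" .
    define w where "w = (norm x / s) *\<^sub>R (p - q)"
    have "p - q \<in> representable_within S (2 * real n + 1)"
      using representable_within_diff[OF sub p(1) q(1)] by (force simp: representable_within_def)
    then have "w \<in> representable_within S (\<bar>norm x / s\<bar> * (2 * real n + 1))"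
      unfolding w_def by (rule representable_within_scaleR[OF sub])
    then have "w \<in> representable_within S (C * norm x)"
      using s by (simp add: C_def mult.commute)
    moreover have "x - w = (norm x / s) *\<^sub>R (v - (p - q))"
      using False s by (simp add: w_def v_def scaleR_diff_right)
    then have "norm (x - w) \<le> norm x / s * (s / 2)"
      using mult_left_mono[OF near, of "norm x / s"] s by simp
    then have "norm (x - w) \<le> norm x / 2"
      using s by simp
    ultimately show ?thesis by blast
  qed
  moreover have "0 < C" using s by (simp add: C_def)
  ultimately show ?thesis using that by blast
qed

section \<open>The net obtained from uniform smoothness\<close>

text \<open>If every normalised term \<open>y\<close> of the series for \<open>w\<close> violated the bound, then summing the
  violations with weights \<open>norm (u k)\<close> would contradict that \<open>w\<close> is close to \<open>x\<close>.\<close>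

lemma exists_direction_of_increase:
  fixes S :: "nat \<Rightarrow> 'a::banach set"
  assumes sub: "\<And>k. subspace (S k)"
    and w: "w \<in> representable_within S C" "norm (x - w) \<le> 1 / 2"
    and "0 < C" "norm x = 1" "0 < \<tau>"
  obtains y where "y \<in> sphere_union S" "1 + \<tau> / (4 * C) \<le> norm (x + \<tau> *\<^sub>R y)"
proof -
  obtain u where u: "\<forall>k. u k \<in> S k" "summable (\<lambda>k. norm (u k))" "u sums w" "(\<Sum>k. norm (u k)) \<le> C"
    using w(1) unfolding representable_within_def by blast
  define A where "A = (\<Sum>k. norm (u k))"
  define c where "c = 1 / (4 * C)"
  have A: "0 \<le> A" "A \<le> C" "(\<lambda>k. norm (u k)) sums A"
    using u by (auto simp: A_def suminf_nonneg summable_sums)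
  have "\<exists>k. u k \<noteq> 0 \<and> 1 + \<tau> * c \<le> norm (x + \<tau> *\<^sub>R (u k /\<^sub>R norm (u k)))"
  proof (rule ccontr)
    assume neg: "\<not> ?thesis"
    have le: "norm (norm (u k) *\<^sub>R x + \<tau> *\<^sub>R u k) \<le> norm (u k) * (1 + \<tau> * c)" for k
    proof (cases "u k = 0")
      case False
      have "norm (u k) *\<^sub>R x + \<tau> *\<^sub>R u k = norm (u k) *\<^sub>R (x + \<tau> *\<^sub>R (u k /\<^sub>R norm (u k)))"
        using False by (simp add: scaleR_add_right)
      moreover have "norm (x + \<tau> *\<^sub>R (u k /\<^sub>R norm (u k))) \<le> 1 + \<tau> * c"
        using neg False by force
      ultimately show ?thesis
        by (simp only: norm_scaleR abs_norm_cancel mult_left_mono norm_ge_zero)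
    qed simp
    have sums: "(\<lambda>k. norm (u k) *\<^sub>R x + \<tau> *\<^sub>R u k) sums (A *\<^sub>R x + \<tau> *\<^sub>R w)"
      using A(3) u(3) by (intro sums_add sums_scaleR_left sums_scaleR_right)
    have maj: "(\<lambda>k. norm (u k) * (1 + \<tau> * c)) sums (A * (1 + \<tau> * c))"
      using A(3) by (rule sums_mult2)
    have summ: "summable (\<lambda>k. norm (norm (u k) *\<^sub>R x + \<tau> *\<^sub>R u k))"
      by (rule summable_comparison_test'[OF sums_summable[OF maj]]) (use le in auto)
    have "norm (A *\<^sub>R x + \<tau> *\<^sub>R w) \<le> (\<Sum>k. norm (norm (u k) *\<^sub>R x + \<tau> *\<^sub>R u k))"
      using summable_norm[OF summ] sums by (simp add: sums_iff)
    also have "\<dots> \<le> A * (1 + \<tau> * c)"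
      using suminf_le[OF le summ sums_summable[OF maj]] maj by (simp add: sums_iff)
    finally have upper: "norm (A *\<^sub>R x + \<tau> *\<^sub>R w) \<le> A * (1 + \<tau> * c)" .
    \<comment> \<open>On the other hand \<open>w\<close> is close to \<open>x\<close>, so the norm of \<open>A x + \<tau> w\<close> is at least
      \<open>A + \<tau> / 2\<close>.\<close>
    have "(A + \<tau>) *\<^sub>R x = (A *\<^sub>R x + \<tau> *\<^sub>R w) + \<tau> *\<^sub>R (x - w)"
      by (simp add: algebra_simps)
    then have "norm ((A + \<tau>) *\<^sub>R x) \<le> norm (A *\<^sub>R x + \<tau> *\<^sub>R w) + norm (\<tau> *\<^sub>R (x - w))"
      by (metis norm_triangle_ineq)
    also have "norm ((A + \<tau>) *\<^sub>R x) = A + \<tau>"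
      using A assms by simp
    also have "norm (\<tau> *\<^sub>R (x - w)) \<le> \<tau> * (1 / 2)"
      using assms by simp
    finally have "A + \<tau> / 2 \<le> A * (1 + \<tau> * c)"
      using upper by simp
    also have "\<dots> = A + \<tau> * (A * c)"
      by (simp add: algebra_simps)
    finally have "1 / 2 \<le> A * c"
      using \<open>0 < \<tau>\<close> by simp
    also have "A * c \<le> 1 / 4"
      using A \<open>0 < C\<close> by (simp add: c_def field_simps)
    finally show False by simp
  qed
  then obtain k where k: "u k \<noteq> 0" "1 + \<tau> * c \<le> norm (x + \<tau> *\<^sub>R (u k /\<^sub>R norm (u k)))"
    by blast
  have "u k /\<^sub>R norm (u k) \<in> sphere_union S"
    unfolding sphere_union_def unit_sphere_of_def
    using k(1) u(1) by (auto intro!: exI[of _ k] subspace_scale[OF sub])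
  with k(2) show ?thesis using that by (simp add: c_def)
qed

lemma uniformly_smooth_bound:
  assumes "uniformly_smooth TYPE('a::real_normed_vector)" and "0 < c"
  obtains \<tau> where "0 < \<tau>" "\<tau> < 1"
    and "\<And>x y::'a. norm x = 1 \<Longrightarrow> norm y = \<tau> \<Longrightarrow> norm (x + y) + norm (x - y) \<le> 2 + 2 * c * \<tau>"
proof -
  have "eventually (\<lambda>\<tau>. modulus_of_smoothness TYPE('a) \<tau> / ennreal \<tau> < ennreal c) (at_right 0)"
    using assms by (auto simp: uniformly_smooth_def intro: order_tendstoD(2))
  moreover have "eventually (\<lambda>\<tau>::real. \<tau> \<in> {0<..<1}) (at_right 0)"
    by (rule eventually_at_right_real) simp
  ultimately have "eventually (\<lambda>\<tau>. modulus_of_smoothness TYPE('a) \<tau> / ennreal \<tau> < ennreal c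
      \<and> \<tau> \<in> {0<..<1}) (at_right 0)"
    by (rule eventually_conj)
  then obtain \<tau> where \<tau>: "modulus_of_smoothness TYPE('a) \<tau> / ennreal \<tau> < ennreal c" "0 < \<tau>" "\<tau> < 1"
    using eventually_happens'[OF trivial_limit_at_right_real] by auto
  then have rho: "modulus_of_smoothness TYPE('a) \<tau> < ennreal (c * \<tau>)"
    using \<open>0 < c\<close> by (simp add: divide_less_ennreal ennreal_mult)
  have "norm (x + y) + norm (x - y) \<le> 2 + 2 * c * \<tau>" if "norm x = 1" "norm y = \<tau>" for x y :: 'a
  proof -
    have "ennreal ((norm (x + y) + norm (x - y)) / 2 - 1) \<le> modulus_of_smoothness TYPE('a) \<tau>"
      unfolding modulus_of_smoothness_def by (rule Sup_upper) (use that in blast)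
    also have "\<dots> \<le> ennreal (c * \<tau>)" using rho by simp
    finally have "(norm (x + y) + norm (x - y)) / 2 - 1 \<le> c * \<tau>"
      using \<tau> \<open>0 < c\<close> by (subst (asm) ennreal_le_iff) auto
    then show ?thesis by (simp add: field_simps)
  qed
  with \<tau> show ?thesis using that by blast
qed

lemma representing_imp_net:
  fixes S :: "nat \<Rightarrow> 'a::banach set"
  assumes sub: "\<And>k. subspace (S k)" and rep: "absolutely_representing S"
    and smooth: "uniformly_smooth TYPE('a)"
  obtains \<tau> \<mu> where "0 < \<tau>" "\<tau> < 1" "0 < \<mu>" "\<mu> < 1"
    and "is_net \<mu> ((*\<^sub>R) \<tau> ` sphere_union S) (unit_sphere_of UNIV)"
proof -
  obtain C where C: "0 < C"
    and app: "\<And>x. \<exists>w\<in>representable_within S (C * norm x). norm (x - w) \<le> norm x / 2"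
    using representing_imp_controlled_approximation[OF sub rep] by blast
  define c where "c = 1 / (4 * C)"
  have c: "0 < c" using C by (simp add: c_def)
  obtain \<tau> where \<tau>: "0 < \<tau>" "\<tau> < 1"
    and bound: "\<And>x y::'a. norm x = 1 \<Longrightarrow> norm y = \<tau> \<Longrightarrow>
      norm (x + y) + norm (x - y) \<le> 2 + 2 * (c / 4) * \<tau>"
    using uniformly_smooth_bound[OF smooth, of "c / 4"] c by auto
  \<comment> \<open>The maximum only guarantees \<open>0 < \<mu>\<close>.\<close>
  define \<mu> where "\<mu> = max (1 / 2) (1 - c * \<tau> / 2)"
  have "\<exists>y\<in>sphere_union S. norm (x - \<tau> *\<^sub>R y) \<le> \<mu>" if x: "norm x = 1" for x
  proof -
    obtain w where w: "w \<in> representable_within S C" "norm (x - w) \<le> 1 / 2"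
      using app[of x] x by auto
    obtain y where y: "y \<in> sphere_union S" "1 + \<tau> / (4 * C) \<le> norm (x + \<tau> *\<^sub>R y)"
      using exists_direction_of_increase[OF sub w C x \<tau>(1)] by blast
    have "norm (\<tau> *\<^sub>R y) = \<tau>"
      using y(1) \<tau> by (auto simp: sphere_union_def unit_sphere_of_def)
    then have "norm (x + \<tau> *\<^sub>R y) + norm (x - \<tau> *\<^sub>R y) \<le> 2 + 2 * (c / 4) * \<tau>"
      using bound x by blast
    moreover have "1 + c * \<tau> \<le> norm (x + \<tau> *\<^sub>R y)"
      using y(2) by (simp add: c_def)
    ultimately have "norm (x - \<tau> *\<^sub>R y) \<le> 1 - c * \<tau> / 2"
      by simp
    then have "norm (x - \<tau> *\<^sub>R y) \<le> \<mu>" by (simp add: \<mu>_def)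
    then show ?thesis using y(1) by blast
  qed
  then have "is_net \<mu> ((*\<^sub>R) \<tau> ` sphere_union S) (unit_sphere_of UNIV)"
    by (auto simp: is_net_def unit_sphere_of_def)
  moreover have "0 < \<mu>" "\<mu> < 1"
    using c \<tau> by (auto simp: \<mu>_def)
  ultimately show ?thesis using that \<tau> by blast
qed

section \<open>The covering defect\<close>

lemma net_imp_covering_defect_less:
  assumes sub: "\<And>k. subspace (S k)" and \<mu>: "0 \<le> \<mu>" "\<mu> < 1"
    and net: "is_net \<mu> ((*\<^sub>R) \<tau> ` sphere_union S) (unit_sphere_of UNIV)"
  shows "covering_defect S < 1"
proof -
  have "(INF k. ennreal (infdist x (S k))) \<le> ennreal \<mu>" if x: "x \<in> unit_sphere_of UNIV" for x
  proof -
    obtain y where "y \<in> sphere_union S" and near: "norm (x - \<tau> *\<^sub>R y) \<le> \<mu>"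
      using net x unfolding is_net_def by blast
    then obtain k where y: "y \<in> S k"
      by (auto simp: sphere_union_def unit_sphere_of_def)
    have "infdist x (S k) \<le> \<mu>"
      by (rule infdist_le2[OF subspace_scale[OF sub y]]) (use near in \<open>simp add: dist_norm\<close>)
    then show ?thesis
      by (intro INF_lower2[of k]) (auto intro: ennreal_leI)
  qed
  then have "covering_defect S \<le> ennreal \<mu>"
    unfolding covering_defect_def by (rule SUP_least)
  also have "\<dots> < 1" using \<mu> by simp
  finally show ?thesis .
qed

lemma covering_defect_less_imp_approximation:
  assumes sub: "\<And>k. subspace (S k)" and "covering_defect S < 1"
  obtains \<mu> where "0 \<le> \<mu>" "\<mu> < 1"
    and "\<And>x. norm x = 1 \<Longrightarrow> \<exists>k. \<exists>y\<in>S k. norm (x - y) \<le> \<mu>"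
proof -
  obtain m where m: "covering_defect S < m" "m < 1"
    using dense[OF assms(2)] by blast
  define \<mu> where "\<mu> = enn2real m"
  have m_eq: "m = ennreal \<mu>"
    using m(2) unfolding \<mu>_def by (intro ennreal_enn2real[symmetric]) (auto intro: less_trans)
  have "0 \<le> \<mu>" by (simp add: \<mu>_def)
  moreover have "\<mu> < 1" using m(2) by (simp add: m_eq)
  moreover have "\<exists>k. \<exists>y\<in>S k. norm (x - y) \<le> \<mu>" if "norm x = 1" for x
  proof -
    have "(INF k. ennreal (infdist x (S k))) \<le> covering_defect S"
      unfolding covering_defect_def by (rule SUP_upper) (simp add: unit_sphere_of_def that)
    then have "(INF k. ennreal (infdist x (S k))) < ennreal \<mu>"
      using m(1) by (simp add: m_eq)
    then obtain k where "infdist x (S k) < \<mu>"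
      by (auto simp: INF_less_iff ennreal_less_iff infdist_nonneg)
    moreover have "S k \<noteq> {}" using subspace_0[OF sub] by blast
    ultimately have "\<exists>y\<in>S k. dist x y < \<mu>"
      by (simp add: infdist_notempty cINF_less_iff)
    then show ?thesis by (force simp: dist_norm)
  qed
  ultimately show ?thesis using that by blast
qed

lemma (in normed_space_over) real_subspace:
  assumes "subspace V"
  shows "Real_Vector_Spaces.subspace V"
proof (rule real_vector.subspaceI)
  fix r :: real and x assume "x \<in> V"
  then have "sc (of_real r) x \<in> V" by (rule subspace_scale[OF assms])
  then show "r *\<^sub>R x \<in> V" by (simp only: sc_of_real)
qed (use assms subspace_0 subspace_add in auto)

theorem mainTheorem9:
  fixes sc :: "'k::real_normed_field \<Rightarrow> 'a::banach \<Rightarrow> 'a"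
    and S :: "nat \<Rightarrow> 'a set"
  assumes "normed_space_over sc"
    and "uniformly_smooth TYPE('a)"
    and "subspace_system sc S"
  shows "(absolutely_representing S \<longleftrightarrow>
            (\<exists>\<tau> \<mu>. 0 < \<tau> \<and> \<tau> < 1 \<and> 0 < \<mu> \<and> \<mu> < 1 \<and>
               is_net \<mu> ((*\<^sub>R) \<tau> ` sphere_union S) (unit_sphere_of UNIV)))
       \<and> (absolutely_representing S \<longleftrightarrow> covering_defect S < 1)"
    (is "(?rep \<longleftrightarrow> ?net) \<and> (?rep \<longleftrightarrow> ?defect)")
proof -
  have sub: "subspace (S k)" and cl: "closed (S k)" for k
    using assms normed_space_over.real_subspace by (auto simp: subspace_system_def)
  have "?net" if ?rep
    using representing_imp_net[OF sub that assms(2)] by metis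
  moreover have "?defect" if net: ?net
  proof -
    obtain \<tau> \<mu> where "0 < \<mu>" "\<mu> < 1"
      and "is_net \<mu> ((*\<^sub>R) \<tau> ` sphere_union S) (unit_sphere_of UNIV)"
      using net by blast
    then show ?thesis
      by (intro net_imp_covering_defect_less[OF sub]) auto
  qed
  moreover have "?rep" if defect: ?defect
  proof -
    obtain \<mu> where "0 \<le> \<mu>" "\<mu> < 1"
      and "\<And>x. norm x = 1 \<Longrightarrow> \<exists>k. \<exists>y\<in>S k. norm (x - y) \<le> \<mu>"
      using covering_defect_less_imp_approximation[OF sub defect] by blast
    then show ?thesis
      by (rule absolutely_representing_of_approximation[OF sub cl])
  qed
  ultimately show ?thesis by blast
qed

end
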